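(* There exist absolute constants $C,D>0$ such that the following holds. Let $n=2^\ell$, let $S\subseteq\mathbb{F}_2^u$ have size $m$, and let $\lambda:=m/n$. Let $h:\mathbb{F}_2^u\to\mathbb{F}_2^\ell$ be a uniformly random linear map. Then for every $T>0$ satisfying $T\ge D\lambda n^{1/T}$, \[ \Pr_h[\mathsf M(S,h)\ge T]\le C\left(\frac{\lambda n^{1/T}}{T}\right)^2. \]
   Context: A uniformly random linear map is chosen uniformly among all linear maps $\mathbb{F}_2^u\to\mathbb{F}_2^\ell$. For a linear map $h$ and $S\subseteq\mathbb{F}_2^u$, $\mathsf M(S,h):=\max_{y\in\mathbb{F}_2^\ell}|h^{-1}(y)\cap S|$. *)

theory Defs
  imports "HOL-Library.FuncSet" Complex_Main
begin

text \<open>Vectors of F_2^k are boolean lists of length k; F_2 addition is xor,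
  scalar multiplication by c in F_2 is conjunction.\<close>

definition f2vecs :: "nat \<Rightarrow> bool list set" where
  "f2vecs k = {xs. length xs = k}"

definition vadd :: "bool list \<Rightarrow> bool list \<Rightarrow> bool list" where
  "vadd xs ys = map2 (\<lambda>a b. a \<noteq> b) xs ys"

definition smul :: "bool \<Rightarrow> bool list \<Rightarrow> bool list" where
  "smul c xs = map (\<lambda>a. c \<and> a) xs"

definition linear_maps :: "nat \<Rightarrow> nat \<Rightarrow> (bool list \<Rightarrow> bool list) set" where
  "linear_maps u l = {h \<in> f2vecs u \<rightarrow>\<^sub>E f2vecs l.
      (\<forall>x\<in>f2vecs u. \<forall>y\<in>f2vecs u. h (vadd x y) = vadd (h x) (h y)) \<and>
      (\<forall>c. \<forall>x\<in>f2vecs u. h (smul c x) = smul c (h x))}"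

definition maxload :: "nat \<Rightarrow> bool list set \<Rightarrow> (bool list \<Rightarrow> bool list) \<Rightarrow> nat" where
  "maxload l S h = Max ((\<lambda>y. card {x\<in>S. h x = y}) ` f2vecs l)"

definition prob_lin :: "nat \<Rightarrow> nat \<Rightarrow> ((bool list \<Rightarrow> bool list) \<Rightarrow> bool) \<Rightarrow> real" where
  "prob_lin u l P = real (card {h \<in> linear_maps u l. P h}) / real (card (linear_maps u l))"

end

theory Submission
  imports Defs
begin

text \<open>
  Fold the space \<open>F_2^(u+l)\<close>, which contains \<open>S\<close> as \<open>S \<times> 0\<close>, onto \<open>F_2^l\<close> by identifying, one coordinate
  after the other, \<open>(1, y)\<close> with \<open>(0, y + w)\<close> for a fresh uniformly random \<open>w\<close>; on \<open>F_2^u\<close> this is a uniformly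
  random linear map. Let \<open>\<Phi>\<close> be the average of \<open>c^f\<close> over the bins, \<open>f\<close> being the current load and
  \<open>c = e n^(1/T)\<close>. A folding step replaces \<open>\<Phi>\<close> in expectation by the product of its values on the two halves,
  hence by at most \<open>\<Phi>\<^sup>2\<close>. Load \<open>T\<close> at the end means \<open>\<Phi> \<ge> e^T\<close>, and as the \<open>2^k\<close>-th root of \<open>\<Phi>\<close> with \<open>k\<close> steps
  already performed is a supermartingale, load \<open>T\<close> has probability at most \<open>\<Phi> exp(-T/2^k)\<close> when \<open>k\<close> steps remain.

  While \<open>\<psi> = \<Phi> - 1\<close> is small, its excess over the least possible value \<open>t_k = (c-1)m/2^(k+l)\<close> grows in
  expectation by a factor below 3 plus \<open>2 t_k\<^sup>2\<close>, while \<open>t_k\<^sup>2\<close> grows by a factor 4; so \<open>\<psi>\<close> reaches \<open>1/2\<close> with \<open>k\<close>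
  steps remaining with probability \<open>O(t_k\<^sup>2)\<close>, after which load \<open>T\<close> has probability \<open>O(exp(-T/2^k))\<close>. Summing
  \<open>t_k\<^sup>2 exp(-T/2^k)\<close> over \<open>k\<close>, with \<open>t_k\<close> at most \<open>e (\<lambda> n^(1/T)/T) (T/2^k)\<close>, gives the square in the bound.
\<close>

subsection \<open>Vectors over F_2\<close>

lemma finite_f2vecs [simp]: "finite (f2vecs k)"
  and card_f2vecs [simp]: "card (f2vecs k) = 2 ^ k"
  using finite_lists_length_eq[of "UNIV :: bool set" k] card_lists_length_eq[of "UNIV :: bool set" k]
  by (simp_all add: f2vecs_def)

lemma length_vadd [simp]: "length (vadd x y) = min (length x) (length y)"
  by (simp add: vadd_def)

lemma vadd_in_f2vecs [simp]: "x \<in> f2vecs k \<Longrightarrow> y \<in> f2vecs k \<Longrightarrow> vadd x y \<in> f2vecs k"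
  by (simp add: f2vecs_def)

lemma nth_vadd [simp]: "i < length x \<Longrightarrow> i < length y \<Longrightarrow> vadd x y ! i = (x ! i \<noteq> y ! i)"
  by (simp add: vadd_def)

lemma vadd_Cons [simp]: "vadd (a # x) (b # y) = (a \<noteq> b) # vadd x y"
  by (simp add: vadd_def)

lemma vadd_append:
  "length x = length x' \<Longrightarrow> vadd (x @ y) (x' @ y') = vadd x x' @ vadd y y'"
  by (simp add: vadd_def)

lemma vadd_commute: "vadd x y = vadd y x"
  by (rule nth_equalityI) auto

lemma vadd_assoc: "vadd (vadd x y) z = vadd x (vadd y z)"
  by (rule nth_equalityI) auto

lemma vadd_left_commute: "vadd x (vadd y z) = vadd y (vadd x z)"
  by (metis vadd_assoc vadd_commute)

lemma vadd_cancel: "length x = length y \<Longrightarrow> vadd (vadd x y) y = x"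
  by (rule nth_equalityI) auto

lemma vadd_self: "vadd x x = replicate (length x) False"
  by (rule nth_equalityI) auto

lemma vadd_zero: "vadd x (replicate (length x) False) = x"
  by (rule nth_equalityI) auto

lemma vadd_eq_zero_iff: "length x = l \<Longrightarrow> length y = l \<Longrightarrow> vadd x y = replicate l False \<longleftrightarrow> x = y"
  by (auto simp: list_eq_iff_nth_eq)

lemma bij_betw_vadd: "w \<in> f2vecs k \<Longrightarrow> bij_betw (\<lambda>y. vadd y w) (f2vecs k) (f2vecs k)"
  by (rule bij_betw_byWitness[where f' = "\<lambda>y. vadd y w"]) (auto simp: vadd_cancel f2vecs_def)

lemma sum_vadd:
  fixes g :: "bool list \<Rightarrow> 'a :: comm_monoid_add"
  shows "w \<in> f2vecs k \<Longrightarrow> (\<Sum>y\<in>f2vecs k. g (vadd y w)) = (\<Sum>y\<in>f2vecs k. g y)"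
  using sum.reindex_bij_betw[OF bij_betw_vadd] by blast

lemma f2vecs_SucE:
  assumes "x \<in> f2vecs (Suc k)"
  obtains a x' where "x = a # x'" "x' \<in> f2vecs k"
  using assms by (cases x) (auto simp: f2vecs_def)

lemma sum_f2vecs_Suc:
  fixes g :: "bool list \<Rightarrow> 'a :: comm_monoid_add"
  shows "(\<Sum>y\<in>f2vecs (Suc k). g y) = (\<Sum>y\<in>f2vecs k. g (False # y)) + (\<Sum>y\<in>f2vecs k. g (True # y))"
proof -
  have "f2vecs (Suc k) = Cons False ` f2vecs k \<union> Cons True ` f2vecs k"
    by (auto simp: f2vecs_def length_Suc_conv)
  then have "(\<Sum>y\<in>f2vecs (Suc k). g y) = sum g (Cons False ` f2vecs k) + sum g (Cons True ` f2vecs k)"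
    by (simp only:) (intro sum.union_disjoint; auto)
  then show ?thesis
    by (simp add: sum.reindex)
qed

lemma sum_f2vecs_add:
  fixes g :: "bool list \<Rightarrow> 'a :: comm_monoid_add"
  shows "(\<Sum>y\<in>f2vecs (k + l). g y) = (\<Sum>x\<in>f2vecs k. \<Sum>z\<in>f2vecs l. g (x @ z))"
proof -
  have "bij_betw (\<lambda>(x, z). x @ z) (f2vecs k \<times> f2vecs l) (f2vecs (k + l))"
    by (rule bij_betw_byWitness[where f' = "\<lambda>y. (take k y, drop k y)"]) (auto simp: f2vecs_def)
  from sum.reindex_bij_betw[OF this, of g] show ?thesis
    by (simp add: sum.cartesian_product case_prod_unfold)
qed

subsection \<open>Linear maps\<close>

text \<open>The scalars of F_2 are 1, which acts trivially, and 0, for which 0 x = x + x;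
  homogeneity therefore follows from additivity.\<close>

lemma linear_maps_iff:
  "h \<in> linear_maps k l \<longleftrightarrow> h \<in> f2vecs k \<rightarrow>\<^sub>E f2vecs l \<and>
     (\<forall>x\<in>f2vecs k. \<forall>y\<in>f2vecs k. h (vadd x y) = vadd (h x) (h y))" (is "_ \<longleftrightarrow> ?R")
proof
  assume R: ?R
  have "h (smul c x) = smul c (h x)" if x: "x \<in> f2vecs k" for c x
  proof (cases c)
    case True
    then show ?thesis by (simp add: smul_def)
  next
    case False
    have "h x \<in> f2vecs l" using R x by auto
    then have "smul c (h x) = vadd (h x) (h x)"
      using False by (simp add: smul_def vadd_self map_replicate_const f2vecs_def)
    moreover have "smul c x = vadd x x"
      using False by (simp add: smul_def vadd_self map_replicate_const)
    ultimately show ?thesis using R x by simp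
  qed
  then show "h \<in> linear_maps k l" using R by (auto simp: linear_maps_def)
qed (auto simp: linear_maps_def)

lemma finite_linear_maps [simp]: "finite (linear_maps k l)"
  by (rule finite_subset[of _ "f2vecs k \<rightarrow>\<^sub>E f2vecs l"]) (auto simp: linear_maps_def intro: finite_PiE)

lemma linear_maps_in: "h \<in> linear_maps k l \<Longrightarrow> x \<in> f2vecs k \<Longrightarrow> h x \<in> f2vecs l"
  by (auto simp: linear_maps_def)

lemma linear_maps_vadd:
  "h \<in> linear_maps k l \<Longrightarrow> x \<in> f2vecs k \<Longrightarrow> y \<in> f2vecs k \<Longrightarrow> h (vadd x y) = vadd (h x) (h y)"
  by (auto simp: linear_maps_def)

lemma linear_maps_zero:
  assumes "h \<in> linear_maps k l"
  shows "h (replicate k False) = replicate l False"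
proof -
  have z: "replicate k False \<in> f2vecs k" by (simp add: f2vecs_def)
  from linear_maps_vadd[OF assms z z] linear_maps_in[OF assms z] show ?thesis
    by (simp add: vadd_self f2vecs_def)
qed

definition extend_map :: "nat \<Rightarrow> (bool list \<Rightarrow> bool list) \<Rightarrow> bool list \<Rightarrow> bool list \<Rightarrow> bool list" where
  "extend_map k h z =
     (\<lambda>x\<in>f2vecs (Suc k). if hd x then vadd (h (tl x)) z else h (tl x))"

lemma extend_map_simps:
  assumes "x \<in> f2vecs k"
  shows "extend_map k h z (False # x) = h x" "extend_map k h z (True # x) = vadd (h x) z"
  using assms by (auto simp: extend_map_def f2vecs_def)

lemma extend_map_linear:
  assumes h: "h \<in> linear_maps k l" and z: "z \<in> f2vecs l"
  shows "extend_map k h z \<in> linear_maps (Suc k) l"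
proof -
  have ext: "extend_map k h z \<in> f2vecs (Suc k) \<rightarrow>\<^sub>E f2vecs l"
    using linear_maps_in[OF h] z by (auto simp: extend_map_def f2vecs_def)
  have "extend_map k h z (vadd x y) = vadd (extend_map k h z x) (extend_map k h z y)"
    if xk: "x \<in> f2vecs (Suc k)" and yk: "y \<in> f2vecs (Suc k)" for x y
  proof -
    obtain a x' where x: "x = a # x'" "x' \<in> f2vecs k"
      using f2vecs_SucE[OF xk] by blast
    obtain b y' where y: "y = b # y'" "y' \<in> f2vecs k"
      using f2vecs_SucE[OF yk] by blast
    have hx: "length (h x') = length z" and hy: "length (h y') = length z"
      using linear_maps_in[OF h] x y z by (auto simp: f2vecs_def)
    have "vadd (vadd (h x') z) (vadd (h y') z) = vadd (vadd (vadd (h x') (h y')) z) z"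
      by (simp add: vadd_assoc vadd_commute vadd_left_commute)
    also have "\<dots> = vadd (h x') (h y')"
      using hx hy by (simp add: vadd_cancel)
    finally have e: "vadd (vadd (h x') z) (vadd (h y') z) = vadd (h x') (h y')" .
    show ?thesis using x y e
      by (cases a; cases b)
        (simp_all add: extend_map_simps linear_maps_vadd[OF h] vadd_assoc vadd_commute vadd_left_commute)
  qed
  with ext show ?thesis by (simp add: linear_maps_iff)
qed

text \<open>A linear map amounts to its restriction to the hyperplane of first coordinate 0 and the
  image of the first basis vector, both free. So a uniform map on \<open>k + 1\<close> coordinates
  is a uniform map on \<open>k\<close> coordinates with an independent uniform vector.\<close>

lemma bij_betw_extend_map:
  "bij_betw (\<lambda>(h, z). extend_map k h z) (linear_maps k l \<times> f2vecs l) (linear_maps (Suc k) l)"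
proof -
  define e where "e = True # replicate k False"
  have e: "e \<in> f2vecs (Suc k)" by (simp add: e_def f2vecs_def)
  define restr where "restr H = ((\<lambda>x\<in>f2vecs k. H (False # x)), H e)" for H :: "bool list \<Rightarrow> bool list"
  have C: "b # x \<in> f2vecs (Suc k)" if "x \<in> f2vecs k" for b x using that by (simp add: f2vecs_def)
  show ?thesis
  proof (rule bij_betw_byWitness[where f' = restr])
    show "\<forall>p\<in>linear_maps k l \<times> f2vecs l. restr ((\<lambda>(h, z). extend_map k h z) p) = p"
    proof clarsimp
      fix h z assume h: "h \<in> linear_maps k l" and z: "z \<in> f2vecs l"
      have "(\<lambda>x\<in>f2vecs k. extend_map k h z (False # x)) = h"
        using h by (intro ext) (auto simp: extend_map_simps linear_maps_def restrict_def
            dest: PiE_arb)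
      moreover have "extend_map k h z e = z"
      proof -
        have "replicate k False \<in> f2vecs k" by (simp add: f2vecs_def)
        then have "extend_map k h z e = vadd (replicate l False) z"
          by (simp add: e_def extend_map_simps linear_maps_zero[OF h])
        then show ?thesis
          using z vadd_zero[of z] by (simp add: vadd_commute f2vecs_def)
      qed
      ultimately show "restr (extend_map k h z) = (h, z)" by (simp add: restr_def)
    qed
    show "\<forall>H\<in>linear_maps (Suc k) l. (\<lambda>(h, z). extend_map k h z) (restr H) = H"
    proof
      fix H assume H: "H \<in> linear_maps (Suc k) l"
      have "extend_map k (\<lambda>x\<in>f2vecs k. H (False # x)) (H e) x = H x" for x
      proof (cases "x \<in> f2vecs (Suc k)")
        case False
        then show ?thesis using H by (auto simp: extend_map_def linear_maps_def dest: PiE_arb)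
      next
        case True
        obtain a x' where x: "x = a # x'" and x': "x' \<in> f2vecs k"
          using f2vecs_SucE[OF True] by blast
        show ?thesis
        proof (cases a)
          case False
          then show ?thesis using x x' by (simp add: extend_map_simps)
        next
          case True
          have "vadd (H (False # x')) (H e) = H (vadd (False # x') e)"
            using linear_maps_vadd[OF H C[OF x'] e] by simp
          also have "vadd (False # x') e = True # x'"
            using x' vadd_zero[of x'] by (simp add: e_def f2vecs_def)
          finally show ?thesis using x x' True by (simp add: extend_map_simps)
        qed
      qed
      then show "(\<lambda>(h, z). extend_map k h z) (restr H) = H" by (auto simp: restr_def)
    qed
    show "(\<lambda>(h, z). extend_map k h z) ` (linear_maps k l \<times> f2vecs l) \<subseteq> linear_maps (Suc k) l"
      by (auto intro: extend_map_linear)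
    show "restr ` linear_maps (Suc k) l \<subseteq> linear_maps k l \<times> f2vecs l"
    proof (rule image_subsetI)
      fix H assume H: "H \<in> linear_maps (Suc k) l"
      have "(\<lambda>x\<in>f2vecs k. H (False # x)) \<in> linear_maps k l"
        unfolding linear_maps_iff
        using linear_maps_in[OF H C] linear_maps_vadd[OF H C C, of _ _ False False] by auto
      then show "restr H \<in> linear_maps k l \<times> f2vecs l"
        using linear_maps_in[OF H e] by (simp add: restr_def)
    qed
  qed
qed

lemma card_linear_maps_Suc:
  "card (linear_maps (Suc k) l) = card (linear_maps k l) * 2 ^ l"
  using bij_betw_same_card[OF bij_betw_extend_map, of k l] by (simp add: card_cartesian_product)

lemma linear_maps_0: "linear_maps 0 l = {\<lambda>x\<in>f2vecs 0. replicate l False}"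
proof -
  have f0 [simp]: "f2vecs 0 = {[]}" by (simp add: f2vecs_def)
  have "h = (\<lambda>x\<in>{[]}. replicate l False)" if h: "h \<in> linear_maps 0 l" for h
  proof
    fix x
    have "h \<in> extensional {[]}" using h by (simp add: linear_maps_def PiE_def)
    then show "h x = (\<lambda>x\<in>{[]}. replicate l False) x"
      using linear_maps_zero[OF h] by (simp add: extensional_def)
  qed
  moreover have "(\<lambda>x\<in>{[]}. replicate l False) \<in> linear_maps 0 l"
  proof -
    have "vadd [] [] = []" by (simp add: vadd_def)
    moreover have "vadd (replicate l False) (replicate l False) = replicate l False"
      by (simp add: vadd_self)
    moreover have "replicate l False \<in> f2vecs l" by (simp add: f2vecs_def)
    ultimately show ?thesis unfolding linear_maps_iff by (intro conjI PiE_I) simp_all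
  qed
  ultimately show ?thesis unfolding f0 by blast
qed

subsection \<open>Folding one coordinate at a time\<close>

text \<open>Push-forward of \<open>f\<close> to the quotient by the line through
  \<open>True # w\<close>, each coset being represented by its member with first coordinate
  0.\<close>

definition fold_load :: "bool list \<Rightarrow> (bool list \<Rightarrow> nat) \<Rightarrow> bool list \<Rightarrow> nat" where
  "fold_load w f y = f (False # y) + f (True # vadd y w)"

text \<open>Here \<open>f\<close> lives on F_2^(k+l), with \<open>k\<close> folds to come. The
  vector \<open>w\<close> ranges over all remaining coordinates, not only the last \<open>l\<close>;
  this makes the two halves independent in \<open>potential_fold_average\<close>.\<close>

primrec overload_prob :: "nat \<Rightarrow> real \<Rightarrow> nat \<Rightarrow> (bool list \<Rightarrow> nat) \<Rightarrow> real" where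
  "overload_prob l T 0 f = of_bool (\<exists>y\<in>f2vecs l. real (f y) \<ge> T)"
| "overload_prob l T (Suc k) f =
     (\<Sum>w\<in>f2vecs (k + l). overload_prob l T k (fold_load w f)) / 2 ^ (k + l)"

lemma overload_prob_nonneg: "overload_prob l T k f \<ge> 0"
  by (induction k arbitrary: f) (auto intro!: sum_nonneg divide_nonneg_nonneg)

lemma overload_prob_le_1: "overload_prob l T k f \<le> 1"
proof (induction k arbitrary: f)
  case (Suc k)
  have "(\<Sum>w\<in>f2vecs (k + l). overload_prob l T k (fold_load w f)) \<le> (\<Sum>w\<in>f2vecs (k + l). 1)"
    by (rule sum_mono) (rule Suc)
  then show ?case by (simp add: field_simps)
qed auto

text \<open>Load of bin \<open>y\<close> under the linear map (x, z) -> z + h x, the form taken by a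
  composition of \<open>k\<close> folds.\<close>

definition shear_load :: "nat \<Rightarrow> (bool list \<Rightarrow> nat) \<Rightarrow> (bool list \<Rightarrow> bool list) \<Rightarrow> bool list \<Rightarrow> nat" where
  "shear_load k f h y = (\<Sum>x\<in>f2vecs k. f (x @ vadd y (h x)))"

text \<open>In the quotient by (1, v, w) the first basis vector becomes (v, w), which the shear by
  \<open>h\<close> sends to w + h v.\<close>

lemma shear_load_fold:
  assumes h: "h \<in> linear_maps k l" and v: "v \<in> f2vecs k" and w: "w \<in> f2vecs l" and y: "y \<in> f2vecs l"
  shows "shear_load k (fold_load (v @ w) f) h y = shear_load (Suc k) f (extend_map k h (vadd w (h v))) y"
proof -
  define g where "g x = f (True # x @ vadd y (vadd (h x) (vadd w (h v))))" for x
  \<comment> \<open>The half with first coordinate 1 evaluates \<open>g\<close> at translated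
    points, and a sum over F_2^k is translation invariant.\<close>
  have "f (True # vadd (x @ vadd y (h x)) (v @ w)) = g (vadd x v)" if x: "x \<in> f2vecs k" for x
  proof -
    have len: "length (h x) = l" "length (h v) = l" "length w = l" "length y = l" "length x = length v"
      using linear_maps_in[OF h] x v w y by (auto simp: f2vecs_def)
    have "vadd y (vadd (vadd (h x) (h v)) (vadd w (h v))) = vadd (vadd (vadd (vadd y (h x)) w) (h v)) (h v)"
      by (simp add: vadd_assoc vadd_commute vadd_left_commute)
    also have "\<dots> = vadd (vadd y (h x)) w" using len by (simp add: vadd_cancel)
    finally show ?thesis
      using len by (simp add: g_def vadd_append linear_maps_vadd[OF h x v])
  qed
  then have "(\<Sum>x\<in>f2vecs k. f (True # vadd (x @ vadd y (h x)) (v @ w))) = (\<Sum>x\<in>f2vecs k. g x)"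
    by (simp add: sum_vadd[OF v])
  then show ?thesis
    by (simp add: shear_load_def fold_load_def sum.distrib sum_f2vecs_Suc extend_map_simps g_def)
qed

lemma overload_prob_eq:
  "overload_prob l T k f =
     (\<Sum>h\<in>linear_maps k l. of_bool (\<exists>y\<in>f2vecs l. real (shear_load k f h y) \<ge> T)) / card (linear_maps k l)"
proof (induction k arbitrary: f)
  case 0
  have "shear_load 0 f (\<lambda>x\<in>f2vecs 0. replicate l False) y = f y" if "y \<in> f2vecs l" for y
    using that vadd_zero[of y] by (simp add: shear_load_def f2vecs_def)
  then show ?case by (simp add: linear_maps_0 del: restrict_apply cong: bex_cong)
next
  case (Suc k)
  define I where "I H = (of_bool (\<exists>y\<in>f2vecs l. real (shear_load (Suc k) f H y) \<ge> T) :: real)" for H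
  let ?c = "real (card (linear_maps k l))"
  have "overload_prob l T (Suc k) f =
      (\<Sum>v\<in>f2vecs k. \<Sum>w\<in>f2vecs l. (\<Sum>h\<in>linear_maps k l. I (extend_map k h (vadd w (h v)))) / ?c) / 2 ^ (k + l)"
    unfolding overload_prob.simps sum_f2vecs_add Suc I_def
    by (intro arg_cong2[where f = "(/)"] sum.cong refl arg_cong[where f = of_bool] bex_cong)
      (simp add: shear_load_fold)
  also have "(\<Sum>v\<in>f2vecs k. \<Sum>w\<in>f2vecs l. (\<Sum>h\<in>linear_maps k l. I (extend_map k h (vadd w (h v)))) / ?c)
      = (\<Sum>v\<in>f2vecs k. (\<Sum>h\<in>linear_maps k l. \<Sum>w\<in>f2vecs l. I (extend_map k h (vadd w (h v)))) / ?c)"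
    by (simp add: sum_divide_distrib[symmetric] sum.swap[of _ "f2vecs l" "linear_maps k l"])
  \<comment> \<open>For fixed \<open>v\<close> and \<open>h\<close>, the vector w + h v is uniform
    because \<open>w\<close> is, so \<open>v\<close> drops out of the average.\<close>
  also have "\<dots> = (\<Sum>v\<in>f2vecs k. (\<Sum>h\<in>linear_maps k l. \<Sum>w\<in>f2vecs l. I (extend_map k h w)) / ?c)"
  proof -
    have "(\<Sum>w\<in>f2vecs l. I (extend_map k h (vadd w (h v)))) = (\<Sum>w\<in>f2vecs l. I (extend_map k h w))"
      if "v \<in> f2vecs k" "h \<in> linear_maps k l" for v h
      using sum_vadd[OF linear_maps_in, of h k l v "\<lambda>w. I (extend_map k h w)"] that by simp
    then show ?thesis by (simp cong: sum.cong)
  qed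
  also have "\<dots> = 2 ^ k * ((\<Sum>H\<in>linear_maps (Suc k) l. I H) / ?c)"
    using sum.reindex_bij_betw[OF bij_betw_extend_map, of I k l]
    by (simp add: sum.cartesian_product case_prod_unfold)
  also have "\<dots> / 2 ^ (k + l) = (\<Sum>H\<in>linear_maps (Suc k) l. I H) / card (linear_maps (Suc k) l)"
    by (simp add: card_linear_maps_Suc power_add)
  finally have "overload_prob l T (Suc k) f = (\<Sum>H\<in>linear_maps (Suc k) l. I H) / card (linear_maps (Suc k) l)" .
  then show ?case by (simp only: I_def)
qed

section \<open>The maximum load of a set as the outcome of folding\<close>

lemma maxload_ge_iff:
  "real (maxload l S h) \<ge> T \<longleftrightarrow> (\<exists>y\<in>f2vecs l. real (card {x\<in>S. h x = y}) \<ge> T)"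
proof -
  have ne: "f2vecs l \<noteq> {}" using card_f2vecs[of l] by force
  let ?A = "(\<lambda>y. card {x\<in>S. h x = y}) ` f2vecs l"
  have A: "finite ?A" "?A \<noteq> {}" using ne by auto
  have "Max ?A \<in> ?A" using A by (rule Max_in)
  moreover have "real (card {x\<in>S. h x = y}) \<le> real (Max ?A)" if "y \<in> f2vecs l" for y
    using A that by (intro of_nat_mono Max_ge) auto
  ultimately show ?thesis unfolding maxload_def by (metis (no_types, lifting) imageE order_trans)
qed

definition embed_load :: "nat \<Rightarrow> nat \<Rightarrow> bool list set \<Rightarrow> bool list \<Rightarrow> nat" where
  "embed_load u l S v = of_bool (take u v \<in> S \<and> drop u v = replicate l False)"

text \<open>The shear by \<open>h\<close> sends (x, 0) to h x, so on S x 0 it acts as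
  \<open>h\<close> itself.\<close>

lemma shear_load_embed:
  assumes h: "h \<in> linear_maps u l" and S: "S \<subseteq> f2vecs u" and y: "y \<in> f2vecs l"
  shows "shear_load u (embed_load u l S) h y = card {x\<in>S. h x = y}"
proof -
  have "shear_load u (embed_load u l S) h y = (\<Sum>x\<in>f2vecs u. of_bool (x \<in> S \<and> h x = y))"
    unfolding shear_load_def
  proof (intro sum.cong refl)
    fix x assume x: "x \<in> f2vecs u"
    then have "length (h x) = l" "length x = u" "length y = l"
      using linear_maps_in[OF h x] y by (auto simp: f2vecs_def)
    then show "embed_load u l S (x @ vadd y (h x)) = of_bool (x \<in> S \<and> h x = y)"
      by (auto simp: embed_load_def vadd_eq_zero_iff)
  qed
  also have "\<dots> = card (f2vecs u \<inter> {x. x \<in> S \<and> h x = y})"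
    by (simp add: sum_of_bool_eq)
  also have "f2vecs u \<inter> {x. x \<in> S \<and> h x = y} = {x\<in>S. h x = y}" using S by auto
  finally show ?thesis .
qed

lemma prob_lin_eq_overload_prob:
  assumes "S \<subseteq> f2vecs u"
  shows "prob_lin u l (\<lambda>h. real (maxload l S h) \<ge> T) = overload_prob l T u (embed_load u l S)"
proof -
  have "real (card {h \<in> linear_maps u l. real (maxload l S h) \<ge> T})
      = (\<Sum>h\<in>linear_maps u l. of_bool (real (maxload l S h) \<ge> T))"
    by (simp add: sum_of_bool_eq Collect_conj_eq)
  then show ?thesis
    by (simp add: prob_lin_def overload_prob_eq maxload_ge_iff shear_load_embed[OF _ assms] cong: sum.cong bex_cong)
qed

lemma sum_embed_load:
  assumes "S \<subseteq> f2vecs u"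
  shows "(\<Sum>v\<in>f2vecs (u + l). embed_load u l S v) = card S"
proof -
  have z: "replicate l False \<in> f2vecs l" by (simp add: f2vecs_def)
  have "(\<Sum>v\<in>f2vecs (u + l). embed_load u l S v)
      = (\<Sum>x\<in>f2vecs u. \<Sum>y\<in>f2vecs l. if y = replicate l False then of_bool (x \<in> S) else 0)"
    unfolding sum_f2vecs_add embed_load_def
    by (intro sum.cong refl) (auto simp: f2vecs_def)
  also have "\<dots> = card (f2vecs u \<inter> S)" using z by (simp add: sum_of_bool_eq)
  finally show ?thesis using assms by (simp add: Int_absorb1)
qed

subsection \<open>The exponential potential\<close>

definition potential :: "real \<Rightarrow> nat \<Rightarrow> (bool list \<Rightarrow> nat) \<Rightarrow> real" where
  "potential c i f = (\<Sum>y\<in>f2vecs i. c ^ f y) / 2 ^ i"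

text \<open>For each \<open>y\<close> the point y + w is uniform, so the average of the product of
  the two powers of \<open>c\<close> is the product of the averages over the two halves. AM-GM
  bounds it by the square of the overall mean.\<close>

lemma potential_fold_average:
  "(\<Sum>w\<in>f2vecs i. potential c i (fold_load w f)) / 2 ^ i \<le> (potential c (Suc i) f)\<^sup>2"
proof -
  define A B where "A = (\<Sum>y\<in>f2vecs i. c ^ f (False # y))" and "B = (\<Sum>y\<in>f2vecs i. c ^ f (True # y))"
  have "(\<Sum>w\<in>f2vecs i. \<Sum>y\<in>f2vecs i. c ^ fold_load w f y)
      = (\<Sum>y\<in>f2vecs i. c ^ f (False # y) * (\<Sum>w\<in>f2vecs i. c ^ f (True # vadd w y)))"
    by (subst sum.swap) (simp add: fold_load_def power_add sum_distrib_left vadd_commute)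
  also have "\<dots> = A * B"
    by (simp add: sum_vadd[where g = "\<lambda>y. c ^ f (True # y)"] A_def B_def sum_distrib_right)
  finally have "(\<Sum>w\<in>f2vecs i. potential c i (fold_load w f)) / 2 ^ i = A * B / (2 ^ i)\<^sup>2"
    by (simp add: potential_def sum_divide_distrib[symmetric] power2_eq_square)
  also have "A * B \<le> ((A + B) / 2)\<^sup>2"
    using zero_le_power2[of "A - B"] by (simp add: power2_eq_square field_simps)
  then have "A * B / (2 ^ i)\<^sup>2 \<le> ((A + B) / 2)\<^sup>2 / (2 ^ i)\<^sup>2"
    by (rule divide_right_mono) simp
  also have "\<dots> = (potential c (Suc i) f)\<^sup>2"
    by (simp add: potential_def sum_f2vecs_Suc A_def B_def power_divide power_mult_distrib)
  finally show ?thesis .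
qed

lemma sum_fold_load:
  assumes "w \<in> f2vecs i"
  shows "(\<Sum>y\<in>f2vecs i. fold_load w f y) = (\<Sum>y\<in>f2vecs (Suc i). f y)"
  by (simp add: fold_load_def sum.distrib sum_f2vecs_Suc sum_vadd[OF assms, of "\<lambda>y. f (True # y)"])

text \<open>Bernoulli's inequality in each bin. The lower bound depends only on the total load,
  which folding preserves, so it is the same for all outcomes of the folds.\<close>

lemma potential_ge:
  assumes "c \<ge> 1"
  shows "potential c i f \<ge> 1 + (c - 1) * real (\<Sum>y\<in>f2vecs i. f y) / 2 ^ i"
proof -
  have "(\<Sum>y\<in>f2vecs i. 1 + (c - 1) * real (f y)) \<le> (\<Sum>y\<in>f2vecs i. c ^ f y)"
    using Bernoulli_inequality[of "c - 1"] assms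
    by (intro sum_mono) (simp add: mult.commute[of "c - 1"])
  moreover have "(\<Sum>y\<in>f2vecs i. 1 + (c - 1) * real (f y)) = 2 ^ i + (c - 1) * real (\<Sum>y\<in>f2vecs i. f y)"
    by (simp add: sum.distrib sum_distrib_left)
  ultimately have "(2 ^ i + (c - 1) * real (\<Sum>y\<in>f2vecs i. f y)) / 2 ^ i \<le> potential c i f"
    unfolding potential_def by (intro divide_right_mono) auto
  then show ?thesis by (simp only: add_divide_distrib) simp
qed

lemma potential_ge_1: "c \<ge> 1 \<Longrightarrow> potential c i f \<ge> 1"
  by (rule order_trans[OF _ potential_ge]) (auto intro!: divide_nonneg_nonneg mult_nonneg_nonneg sum_nonneg)

text \<open>Loads 0 and 1 give equality in Bernoulli's inequality: the process starts with no excess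
  over the lower bound.\<close>

lemma potential_embed_load:
  assumes "S \<subseteq> f2vecs u"
  shows "potential c (u + l) (embed_load u l S) = 1 + (c - 1) * real (card S) / 2 ^ (u + l)"
proof -
  have "c ^ embed_load u l S v = 1 + (c - 1) * real (embed_load u l S v)" for v
    by (simp add: embed_load_def)
  then show ?thesis
    by (simp add: potential_def sum.distrib sum_distrib_left[symmetric] add_divide_distrib
        sum_embed_load[OF assms] flip: of_nat_sum)
qed


text \<open>By \<open>K\<close> one bin of load \<open>T\<close> raises the average to at least exp
  T. Before that, a fold at most squares the potential in expectation; since a probability is at
  most 1, the square root of a bound on it is again a bound, which undoes the squaring and halves
  the exponent.\<close>

lemma overload_prob_le_potential:
  assumes c: "c \<ge> 1" and T: "T > 0" and K: "2 ^ l * exp T \<le> c powr T"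
  shows "overload_prob l T k f \<le> potential c (k + l) f * exp (- T / 2 ^ k)"
proof (induction k arbitrary: f)
  case 0
  have pos: "potential c l f \<ge> 0"
    using potential_ge_1[OF c, of l f] by simp
  show ?case
  proof (cases "\<exists>y\<in>f2vecs l. real (f y) \<ge> T")
    case True
    then obtain y where y: "y \<in> f2vecs l" "real (f y) \<ge> T" by auto
    have "2 ^ l * exp T \<le> c powr real (f y)"
      using K y(2) c powr_mono[of T "real (f y)" c] by linarith
    also have "\<dots> = c ^ f y" using c by (simp add: powr_realpow)
    also have "\<dots> \<le> (\<Sum>y\<in>f2vecs l. c ^ f y)"
      using y(1) c by (intro member_le_sum) auto
    finally show ?thesis using True by (simp add: potential_def exp_minus field_simps)
  next
    case False
    then show ?thesis using pos by simp
  qed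
next
  case (Suc k)
  \<comment> \<open>The claimed bound. Its square bounds the average of the induction hypothesis
    over \<open>w\<close>, so linearising the square root at this point loses nothing.\<close>
  define \<theta> where "\<theta> = exp (- T / 2 ^ Suc k) * potential c (Suc k + l) f"
  have \<theta>: "\<theta> > 0"
    using less_le_trans[OF zero_less_one potential_ge_1[OF c]] by (simp add: \<theta>_def)
  have sq: "exp (- T / 2 ^ k) = (exp (- T / 2 ^ Suc k))\<^sup>2"
    by (simp flip: exp_double)
  txt \<open>AM-GM in the form \<open>2 \<theta> W \<le> W\<^sup>2 + \<theta>\<^sup>2 \<le> W + \<theta>\<^sup>2\<close>, valid as \<open>0 \<le> W \<le> 1\<close>.\<close>
  have W: "2 * \<theta> * overload_prob l T k g \<le> potential c (k + l) g * exp (- T / 2 ^ k) + \<theta>\<^sup>2" for g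
  proof -
    let ?W = "overload_prob l T k g"
    have "?W\<^sup>2 \<le> ?W"
      using overload_prob_nonneg overload_prob_le_1 by (simp add: power2_eq_square mult_left_le)
    then show ?thesis
      using Suc[of g] zero_le_power2[of "?W - \<theta>"] by (simp add: power2_diff mult.commute mult.left_commute)
  qed
  have "2 * \<theta> * overload_prob l T (Suc k) f
      = (\<Sum>w\<in>f2vecs (k + l). 2 * \<theta> * overload_prob l T k (fold_load w f)) / 2 ^ (k + l)"
    by (simp add: sum_distrib_left)
  also have "\<dots> \<le> (\<Sum>w\<in>f2vecs (k + l). potential c (k + l) (fold_load w f) * exp (- T / 2 ^ k) + \<theta>\<^sup>2) / 2 ^ (k + l)"
    by (intro divide_right_mono sum_mono W) simp
  also have "\<dots> = (\<Sum>w\<in>f2vecs (k + l). potential c (k + l) (fold_load w f)) / 2 ^ (k + l) * exp (- T / 2 ^ k) + \<theta>\<^sup>2"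
    by (simp add: sum.distrib sum_distrib_right add_divide_distrib)
  also have "\<dots> \<le> (potential c (Suc (k + l)) f)\<^sup>2 * exp (- T / 2 ^ k) + \<theta>\<^sup>2"
    by (intro add_right_mono mult_right_mono potential_fold_average) simp
  also have "\<dots> = 2 * \<theta> * \<theta>"
    unfolding sq by (simp add: \<theta>_def power2_eq_square)
  finally have "overload_prob l T (Suc k) f \<le> \<theta>"
    using \<theta> by (simp del: overload_prob.simps)
  then show ?case by (simp only: \<theta>_def mult.commute)
qed

section \<open>A bound of second order in the mean load\<close>

text \<open>The real inequality behind one fold: \<psi> is the potential minus 1, \<tau> its least
  value, \<open>B\<close> the old slope in the excess. For small \<psi> the slope triples and the
  error 2 B \<tau>^2 is taken from the reserve 8 B \<tau>^2; for large \<psi> the crude bound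
  \<open>A\<close> is absorbed by the extra slope 6 e.\<close>

lemma overload_prob_stage_step:
  fixes e B Q \<tau> \<psi> W :: real
  assumes "B \<ge> 0" "Q \<ge> 0" "e \<ge> 0" "0 \<le> \<tau>" "\<tau> \<le> 1/4" "\<tau> \<le> \<psi>"
    and A: "W \<le> (1 + \<psi>) * e"
    and V: "W \<le> Q - 8 * B * \<tau>\<^sup>2 + B * (2 * \<psi> + \<psi>\<^sup>2 - 2 * \<tau>)"
  shows "W \<le> Q - 6 * B * \<tau>\<^sup>2 + (3 * B + 6 * e) * (\<psi> - \<tau>)"
proof (cases "\<psi> \<le> 1/2")
  case True
  \<comment> \<open>Used with the identity \<psi>^2 = 2 (\<psi> - \<tau>)^2 + 2 \<tau>^2 - (\<psi> -
    2 \<tau>)^2.\<close>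
  have "(\<psi> - \<tau>)\<^sup>2 \<le> (\<psi> - \<tau>) * (1/2)"
    unfolding power2_eq_square using assms True by (intro mult_left_mono) auto
  moreover have "0 \<le> (\<psi> - 2 * \<tau>)\<^sup>2" by simp
  ultimately have "\<psi>\<^sup>2 \<le> 2 * \<tau>\<^sup>2 + (\<psi> - \<tau>)"
    by (simp add: power2_eq_square algebra_simps)
  then have "B * (2 * \<psi> + \<psi>\<^sup>2 - 2 * \<tau>) \<le> B * (3 * (\<psi> - \<tau>) + 2 * \<tau>\<^sup>2)"
    using assms by (intro mult_left_mono) auto
  moreover have "0 \<le> 6 * e * (\<psi> - \<tau>)" using assms by simp
  ultimately show ?thesis using V by (simp add: algebra_simps)
next
  case False
  \<comment> \<open>The thresholds fit: 1 + \<psi> = 6 (\<psi> - \<tau>) at \<psi> = 1/2 and \<tau>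
    = 1/4.\<close>
  have "(1 + \<psi>) * e \<le> (6 * (\<psi> - \<tau>)) * e"
    using assms False by (intro mult_right_mono) auto
  moreover have "\<tau>\<^sup>2 \<le> (1/4)\<^sup>2" using assms by (intro power_mono) auto
  then have "0 \<le> B * (3 * (\<psi> - \<tau>) - 6 * \<tau>\<^sup>2)"
    using assms False by (intro mult_nonneg_nonneg) (auto simp: power2_eq_square)
  ultimately show ?thesis using A \<open>Q \<ge> 0\<close> by (simp add: algebra_simps)
qed

lemma square_mult_exp_minus_le:
  assumes "x \<ge> (0 :: real)"
  shows "x\<^sup>2 * exp (- x) \<le> 2"
proof -
  have "x\<^sup>2 \<le> 2 * exp x" using exp_lower_Taylor_quadratic[OF assms] assms by simp
  then show ?thesis by (simp add: exp_minus field_simps)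
qed

text \<open>The right side is a difference of values of x/(1+x) at 2a and a. Summed over a = T/2^k
  it telescopes, and x/(1+x) < 1 keeps the sum below 12.\<close>

lemma square_mult_exp_minus_le_telescoping:
  assumes "a > (0 :: real)"
  shows "a\<^sup>2 * exp (- a) \<le> 12 * (2 * a / (1 + 2 * a) - a / (1 + a))"
proof -
  \<comment> \<open>The cubic Taylor polynomial of exp, times 12, dominates a (1 + a) (1 +
    2a).\<close>
  have "(\<Sum>n<4. a ^ n /\<^sub>R fact n) \<le> exp a"
    using assms sum_le_suminf[OF summable_exp_generic[of a], of "{..<4}"]
    by (simp add: exp_def)
  then have "12 + 12 * a + 6 * a\<^sup>2 + 2 * a ^ 3 \<le> 12 * exp a"
    by (simp add: eval_nat_numeral lessThan_Suc fact_numeral field_simps)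
  moreover have "a * (1 + a) * (1 + 2 * a) = a + 3 * a\<^sup>2 + 2 * a ^ 3"
    by (simp add: power2_eq_square power3_eq_cube algebra_simps)
  ultimately have "a * (1 + a) * (1 + 2 * a) \<le> 12 * exp a"
    using assms by (smt (verit) zero_le_power2)
  then have "a * (a * (1 + a) * (1 + 2 * a)) \<le> a * (12 * exp a)"
    using assms by (intro mult_left_mono) auto
  then have "a\<^sup>2 * ((1 + a) * (1 + 2 * a)) \<le> (12 * a) * exp a"
    by (simp add: power2_eq_square mult_ac)
  then have "a\<^sup>2 / exp a \<le> 12 * a / ((1 + a) * (1 + 2 * a))"
    using assms by (subst pos_le_divide_eq) (simp_all add: pos_divide_le_eq)
  moreover have "2 * a / (1 + 2 * a) - a / (1 + a) = a / ((1 + a) * (1 + 2 * a))"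
    using assms by (simp add: divide_simps) (simp add: algebra_simps)
  ultimately show ?thesis by (simp add: exp_minus divide_inverse mult.assoc)
qed

text \<open>Start of the induction, at the least \<open>k\<close> with t k at most 1/4, with slope 6
  e. If the excess is large, the slope absorbs the exponential bound; if not, minimality of
  \<open>k\<close> makes e itself O(r^2), or k = 0 and overload is impossible.\<close>

lemma overload_prob_first_stage:
  fixes l m k :: nat and c T r :: real
  defines "t \<equiv> \<lambda>k. (c - 1) * real m / 2 ^ (k + l)"
  assumes c: "c \<ge> 1" and T: "T \<ge> 1" and K: "2 ^ l * exp T \<le> c powr T"
    and tr: "\<And>k. t k \<le> r * (T / 2 ^ k)"
    and small: "t k \<le> 1/4" and large: "\<And>j. k = Suc j \<Longrightarrow> t j > 1/4"
    and f: "(\<Sum>y\<in>f2vecs (k + l). f y) = m"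
  shows "overload_prob l T k f
      \<le> 384 * r\<^sup>2 - 12 * exp (- T / 2 ^ k) * (t k)\<^sup>2
         + 6 * exp (- T / 2 ^ k) * (potential c (k + l) f - 1 - t k)"
proof -
  define e a \<psi> where "e = exp (- T / 2 ^ k)" and "a = T / 2 ^ k" and "\<psi> = potential c (k + l) f - 1"
  have e: "e > 0" "e = exp (- a)" by (simp_all add: e_def a_def)
  have a: "a > 0" using T by (simp add: a_def)
  have t0: "t k \<ge> 0" using c by (simp add: t_def)
  have \<psi>: "t k \<le> \<psi>"
    using potential_ge[OF c, where f = f and i = "k + l"] f by (simp add: \<psi>_def t_def)
  have A: "overload_prob l T k f \<le> (1 + \<psi>) * e"
    using overload_prob_le_potential[OF c _ K, of k f] T by (simp add: \<psi>_def e_def)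
  have a2: "a\<^sup>2 * e \<le> 2"
    using square_mult_exp_minus_le[of a] a e by simp
  have main: "12 * e * (t k)\<^sup>2 + (if \<psi> \<le> 1/2 then overload_prob l T k f else 0) \<le> 384 * r\<^sup>2"
  proof (cases k)
    case 0
    have "(t k)\<^sup>2 \<le> (r * a)\<^sup>2"
      using tr[of k] t0 by (intro power_mono) (simp_all add: a_def)
    then have "e * (t k)\<^sup>2 \<le> e * (r * a)\<^sup>2" using e by (intro mult_left_mono) auto
    also have "\<dots> = r\<^sup>2 * (a\<^sup>2 * e)" by (simp add: power_mult_distrib)
    also have "\<dots> \<le> r\<^sup>2 * 2" using a2 by (intro mult_left_mono) auto
    finally have "e * (t k)\<^sup>2 \<le> r\<^sup>2 * 2" .
    then have "12 * e * (t k)\<^sup>2 \<le> 384 * r\<^sup>2"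
      using zero_le_power2[of r] unfolding mult.assoc by linarith
    \<comment> \<open>With no fold left the probability is an indicator, so a bound below 1 makes it
      0.\<close>
    moreover have "overload_prob l T k f = 0" if "\<psi> \<le> 1/2"
    proof -
      have "exp T \<ge> 2" using exp_ge_add_one_self[of T] T by linarith
      then have "e \<le> 1/2" using 0 by (simp add: e_def exp_minus field_simps)
      then have "(1 + \<psi>) * e \<le> (3/2) * (1/2)"
        using that \<psi> t0 e by (intro mult_mono) auto
      then have "overload_prob l T k f < 1" using A by simp
      then show ?thesis using 0 by (simp split: split_of_bool_asm)
    qed
    ultimately show ?thesis by simp
  next
    case (Suc j)
    \<comment> \<open>Minimality of \<open>k\<close> gives r a > 1/8, and a^2 e is at most 2; hence
      e <= 128 r^2. The needed (3/4 + 3/2) e then fits into 384 r^2 = 3 * 128 r^2.\<close>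
    have "r * (2 * a) = r * (T / 2 ^ j)" by (simp add: a_def Suc)
    then have "r * (2 * a) > 1/4"
      using less_le_trans[OF large[OF Suc] tr[of j]] by (simp only:)
    then have "(1/8)\<^sup>2 \<le> (r * a)\<^sup>2" by (intro power_mono) auto
    then have "e * (1/8)\<^sup>2 \<le> e * (r * a)\<^sup>2" using e by (intro mult_left_mono) auto
    also have "\<dots> = r\<^sup>2 * (a\<^sup>2 * e)" by (simp add: power_mult_distrib)
    also have "\<dots> \<le> r\<^sup>2 * 2" using a2 by (intro mult_left_mono) auto
    finally have er: "e \<le> 128 * r\<^sup>2" by (simp add: power2_eq_square)
    have "(t k)\<^sup>2 \<le> (1/4)\<^sup>2" using small t0 by (intro power_mono) auto
    then have "e * (t k)\<^sup>2 \<le> e * (1/4)\<^sup>2" using e by (intro mult_left_mono) auto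
    then have "12 * e * (t k)\<^sup>2 \<le> 3/4 * e" by (simp add: power2_eq_square)
    moreover have "overload_prob l T k f \<le> (3/2) * e" if "\<psi> \<le> 1/2"
      using that e(1) by (intro order_trans[OF A] mult_right_mono) auto
    then have "(if \<psi> \<le> 1/2 then overload_prob l T k f else 0) \<le> (3/2) * e"
      using e(1) by (simp del: times_divide_eq_left)
    ultimately show ?thesis using er e(1) by linarith
  qed
  have "overload_prob l T k f \<le> 384 * r\<^sup>2 - 12 * e * (t k)\<^sup>2 + 6 * e * (\<psi> - t k)"
  proof (cases "\<psi> \<le> 1/2")
    case True
    moreover have "0 \<le> 6 * e * (\<psi> - t k)" using e \<psi> by simp
    ultimately show ?thesis using main by simp
  next
    case False
    then have "(1 + \<psi>) * e \<le> (6 * (\<psi> - t k)) * e"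
      using e small by (intro mult_right_mono) auto
    then show ?thesis using A main False by (simp add: algebra_simps)
  qed
  then show ?thesis by (simp add: e_def \<psi>_def)
qed

text \<open>The bound is affine in the potential so that it can be averaged over a fold. The term -
  2 B (t k)^2 is a reserve against the squaring of the potential: (t k)^2 loses a factor 4 per step
  of the induction while \<open>B\<close> gains only 3. The value of \<open>B\<close> is left open
  because the initial excess is 0.\<close>

lemma overload_prob_stage:
  fixes l m k k0 :: nat and c T r :: real
  defines "t \<equiv> \<lambda>k. (c - 1) * real m / 2 ^ (k + l)"
    and "\<phi> \<equiv> \<lambda>k. (T / 2 ^ k) / (1 + T / 2 ^ k)"
  assumes c: "c \<ge> 1" and T: "T \<ge> 1" and K: "2 ^ l * exp T \<le> c powr T"
    and tr: "\<And>k. t k \<le> r * (T / 2 ^ k)"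
    and small: "t k0 \<le> 1/4" and large: "\<And>j. k0 = Suc j \<Longrightarrow> t j > 1/4"
    and k: "k0 \<le> k"
  shows "\<exists>B\<ge>0. \<forall>f. (\<Sum>y\<in>f2vecs (k + l). f y) = m \<longrightarrow>
      overload_prob l T k f
      \<le> 384 * r\<^sup>2 + 144 * r\<^sup>2 * (\<phi> k0 - \<phi> k) - 2 * B * (t k)\<^sup>2
         + B * (potential c (k + l) f - 1 - t k)"
  using k
proof (induction k rule: dec_induct)
  case base
  show ?case
    using overload_prob_first_stage[OF c T K tr[unfolded t_def] small[unfolded t_def] large[unfolded t_def]]
    by (intro exI[of _ "6 * exp (- T / 2 ^ k0)"]) (simp add: t_def)
next
  case (step k)
  define e a where "e = exp (- T / 2 ^ Suc k)" and "a = T / 2 ^ Suc k"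
  define Q where "Q = 384 * r\<^sup>2 + 144 * r\<^sup>2 * (\<phi> k0 - \<phi> k)"
  define \<tau> where "\<tau> = t (Suc k)"
  obtain B where B: "B \<ge> 0" and
    IH: "\<And>f. (\<Sum>y\<in>f2vecs (k + l). f y) = m \<Longrightarrow>
      overload_prob l T k f \<le> Q - 2 * B * (t k)\<^sup>2 + B * (potential c (k + l) f - 1 - t k)"
    using step.IH unfolding Q_def by blast
  have a: "a > 0" and ak: "T / 2 ^ k = 2 * a" using T by (simp_all add: a_def)
  have tk: "t k = 2 * \<tau>" by (simp add: t_def \<tau>_def)
  have \<tau>0: "\<tau> \<ge> 0" using c by (simp add: t_def \<tau>_def)
  have "t (Suc k) \<le> t k0"
    using step c unfolding t_def by (intro divide_left_mono power_increasing) auto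
  then have \<tau>4: "\<tau> \<le> 1/4" using small by (simp add: \<tau>_def)
  have "\<phi> k \<le> \<phi> k0"
    unfolding \<phi>_def
  proof -
    have "T / 2 ^ k \<le> T / 2 ^ k0"
      using step T by (intro divide_left_mono power_increasing) auto
    moreover have "x / (1 + x) \<le> y / (1 + y)" if "0 \<le> x" "x \<le> y" for x y :: real
      using that by (simp add: field_simps)
    moreover have "0 \<le> T / 2 ^ k" using T by simp
    ultimately show "T / 2 ^ k / (1 + T / 2 ^ k) \<le> T / 2 ^ k0 / (1 + T / 2 ^ k0)" by blast
  qed
  then have Q: "Q \<ge> 0" by (simp add: Q_def)
  have "\<tau>\<^sup>2 \<le> (r * a)\<^sup>2"
    using tr[of "Suc k"] \<tau>0 by (intro power_mono) (simp_all add: a_def \<tau>_def)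
  \<comment> \<open>The slope 6 e added at this stage needs a reserve 2 * 6 e * \<tau>^2, which the
    increment of the telescoping constant pays for.\<close>
  then have "12 * e * \<tau>\<^sup>2 \<le> 12 * e * (r * a)\<^sup>2"
    by (intro mult_left_mono) (auto simp: e_def)
  also have "\<dots> = 12 * r\<^sup>2 * (a\<^sup>2 * exp (- a))"
    unfolding power_mult_distrib by (simp add: e_def a_def)
  also have "\<dots> \<le> 12 * r\<^sup>2 * (12 * (2 * a / (1 + 2 * a) - a / (1 + a)))"
    by (intro mult_left_mono square_mult_exp_minus_le_telescoping a) auto
  also have "\<dots> = 144 * r\<^sup>2 * (\<phi> k - \<phi> (Suc k))"
    unfolding \<phi>_def ak by (simp add: a_def)
  finally have incr: "Q + 12 * e * \<tau>\<^sup>2 \<le> 384 * r\<^sup>2 + 144 * r\<^sup>2 * (\<phi> k0 - \<phi> (Suc k))"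
    by (simp add: Q_def algebra_simps)
  have "overload_prob l T (Suc k) f
      \<le> 384 * r\<^sup>2 + 144 * r\<^sup>2 * (\<phi> k0 - \<phi> (Suc k)) - 2 * (3 * B + 6 * e) * (t (Suc k))\<^sup>2
         + (3 * B + 6 * e) * (potential c (Suc k + l) f - 1 - t (Suc k))"
    if f: "(\<Sum>y\<in>f2vecs (Suc k + l). f y) = m" for f
  proof -
    define \<psi> where "\<psi> = potential c (Suc k + l) f - 1"
    define V where "V g = Q - 2 * B * (t k)\<^sup>2 - B * (1 + t k) + B * potential c (k + l) g" for g
    have \<psi>: "\<tau> \<le> \<psi>"
      using potential_ge[OF c, where f = f and i = "Suc k + l"] unfolding f by (simp add: \<psi>_def t_def \<tau>_def)
    have "overload_prob l T (Suc k) f \<le> (\<Sum>w\<in>f2vecs (k + l). V (fold_load w f)) / 2 ^ (k + l)"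
    proof -
      have "overload_prob l T k (fold_load w f) \<le> V (fold_load w f)" if "w \<in> f2vecs (k + l)" for w
        using IH[of "fold_load w f"] sum_fold_load[OF that, of f] f by (simp add: V_def algebra_simps)
      then show ?thesis by (auto intro!: divide_right_mono sum_mono)
    qed
    also have "\<dots> = Q - 2 * B * (t k)\<^sup>2 - B * (1 + t k)
        + B * ((\<Sum>w\<in>f2vecs (k + l). potential c (k + l) (fold_load w f)) / 2 ^ (k + l))"
      by (simp add: V_def sum.distrib sum_distrib_left[symmetric] add_divide_distrib)
    also have "\<dots> \<le> Q - 2 * B * (t k)\<^sup>2 - B * (1 + t k) + B * (1 + \<psi>)\<^sup>2"
      using mult_left_mono[OF potential_fold_average[of c "k + l" f] B] by (simp add: \<psi>_def)
    \<comment> \<open>The 8 comes from t k = 2 \<tau>.\<close>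
    also have "\<dots> = Q - 8 * B * \<tau>\<^sup>2 + B * (2 * \<psi> + \<psi>\<^sup>2 - 2 * \<tau>)"
      unfolding tk by (simp add: power2_eq_square algebra_simps)
    finally have V: "overload_prob l T (Suc k) f \<le> \<dots>" .
    have A: "overload_prob l T (Suc k) f \<le> (1 + \<psi>) * e"
      using overload_prob_le_potential[OF c _ K, of "Suc k" f] T by (simp only: \<psi>_def e_def) simp
    have "overload_prob l T (Suc k) f \<le> Q - 6 * B * \<tau>\<^sup>2 + (3 * B + 6 * e) * (\<psi> - \<tau>)"
      by (rule overload_prob_stage_step[OF B Q _ \<tau>0 \<tau>4 \<psi> A V]) (simp add: e_def)
    also have "\<dots> \<le> 384 * r\<^sup>2 + 144 * r\<^sup>2 * (\<phi> k0 - \<phi> (Suc k)) - 2 * (3 * B + 6 * e) * \<tau>\<^sup>2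
         + (3 * B + 6 * e) * (\<psi> - \<tau>)"
      using incr by (simp add: algebra_simps)
    finally show ?thesis unfolding \<psi>_def \<tau>_def .
  qed
  moreover have "3 * B + 6 * e \<ge> 0" using B by (simp add: e_def)
  ultimately show ?case by blast
qed

section \<open>Choice of the base of the potential and of the first stage\<close>

theorem theoremC2:
  "\<exists>C D :: real. C > 0 \<and> D > 0 \<and>
    (\<forall>(l::nat) (u::nat) (S::bool list set) (T::real).
       S \<subseteq> f2vecs u \<longrightarrow> T > 0 \<longrightarrow>
       (let n = (2::real) ^ l; lam = real (card S) / n in
        T \<ge> D * lam * n powr (1 / T) \<longrightarrow>
        prob_lin u l (\<lambda>h. real (maxload l S h) \<ge> T)
          \<le> C * (lam * n powr (1 / T) / T) ^ 2))"
proof -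
  define E :: real where "E = exp 1"
  have E: "E \<ge> 1" by (simp add: E_def)
  have "prob_lin u l (\<lambda>h. real (maxload l S h) \<ge> T) \<le> 528 * E\<^sup>2 * (lam * n powr (1 / T) / T)\<^sup>2"
    if S: "S \<subseteq> f2vecs u" and T0: "T > 0" and n: "n = 2 ^ l" and lam: "lam = real (card S) / n"
      and D: "T \<ge> 4 * E * lam * n powr (1 / T)"
    for l u S and T n lam :: real
  \<comment> \<open>A set with fewer than \<open>T\<close> elements cannot overload a bin. Otherwise
    |S| >= T turns the hypothesis on \<open>T\<close> into 4 e n^(1/T) <= n.\<close>
  proof (cases "real (card S) < T")
    case True
    have "finite S" using S finite_subset by fastforce
    then have "card {x \<in> S. h x = y} \<le> card S" for h :: "bool list \<Rightarrow> bool list" and y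
      by (intro card_mono) auto
    then have "real (card {x \<in> S. h x = y}) < T" for h :: "bool list \<Rightarrow> bool list" and y
      using True by (rule le_less_trans[OF of_nat_mono])
    then have "\<not> real (maxload l S h) \<ge> T" for h
      by (simp add: maxload_ge_iff not_le)
    then show ?thesis by (simp add: prob_lin_def)
  next
    case False
    define m N c r where "m = card S" and "N = n powr (1 / T)" and "c = E * N"
      and "r = E * (lam * N / T)"
    define t where "t k = (c - 1) * real m / 2 ^ (k + l)" for k
    have mT: "real m \<ge> T" using False by (simp add: m_def)
    have n1: "n \<ge> 1" by (simp add: n)
    have N1: "N \<ge> 1" using n1 T0 by (simp add: N_def ge_one_powr_ge_zero)
    have c1: "c \<ge> 1" using mult_mono[OF E N1] E by (simp add: c_def)
    have D': "4 * (E * N) * real m \<le> T * n"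
      using D n1 by (simp add: lam N_def m_def field_simps)
    have EN: "4 * (E * N) \<le> n"
    proof -
      have "4 * (E * N) * T \<le> n * T"
        using order_trans[OF mult_left_mono[OF mT] D'] E N1 by (simp add: mult.commute)
      then show ?thesis using T0 by simp
    qed
    have T1: "T \<ge> 1"
    proof (rule ccontr)
      \<comment> \<open>For T < 1 the power n^(1/T) would be at least n.\<close>
      assume "\<not> T \<ge> 1"
      then have "n powr 1 \<le> N"
        unfolding N_def using n1 T0 by (intro powr_mono) (auto simp: field_simps)
      then have "n \<le> N" using n1 by simp
      moreover have "N \<le> E * N" using E N1 by simp
      ultimately show False using EN N1 by linarith
    qed
    \<comment> \<open>The base c = e n^(1/T) is chosen so that \<open>K\<close> holds with
      equality.\<close>
    have "c powr T = E powr T * N powr T"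
      using E N1 by (simp add: c_def powr_mult)
    also have "\<dots> = exp T * n"
      using T0 n1 by (simp add: E_def N_def powr_powr powr_def flip: exp_add)
    finally have K: "2 ^ l * exp T \<le> c powr T" by (simp add: n mult.commute)
    have tr: "t k \<le> r * (T / 2 ^ k)" for k
    proof -
      have "t k \<le> c * real m / 2 ^ (k + l)"
        unfolding t_def by (intro divide_right_mono mult_right_mono) auto
      also have "\<dots> = r * (T / 2 ^ k)"
        using T0 by (simp add: r_def c_def lam n m_def power_add mult_ac)
      finally show ?thesis .
    qed
    have "card S \<le> card (f2vecs u)" using S by (intro card_mono) auto
    then have mu: "real m \<le> 2 ^ u" by (simp add: m_def)
    have "t u \<le> c * 2 ^ u / 2 ^ (u + l)"
      unfolding t_def using mu c1 by (intro divide_right_mono mult_mono) auto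
    also have "\<dots> = (E * N) / n" by (simp add: c_def n power_add)
    also have "\<dots> \<le> 1/4" using EN n1 by (simp add: field_simps)
    finally have tu: "t u \<le> 1/4" .
    \<comment> \<open>Least number of remaining folds at which the minimal excess is still at most
      1/4; it is at most \<open>u\<close> because |S| <= 2^u.\<close>
    define k0 where "k0 = (LEAST k. t k \<le> 1/4)"
    have k0: "t k0 \<le> 1/4" "k0 \<le> u"
      unfolding k0_def using tu by (rule LeastI, rule Least_le)
    have large: "t j > 1/4" if "k0 = Suc j" for j
      using not_less_Least[of j "\<lambda>k. t k \<le> 1/4"] that by (simp add: k0_def)
    define \<phi> where "\<phi> k = (T / 2 ^ k) / (1 + T / 2 ^ k)" for k :: nat
    obtain B where B: "B \<ge> 0" and bound: "\<And>f. (\<Sum>y\<in>f2vecs (u + l). f y) = m \<Longrightarrow>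
      overload_prob l T u f \<le> 384 * r\<^sup>2 + 144 * r\<^sup>2 * (\<phi> k0 - \<phi> u) - 2 * B * (t u)\<^sup>2
         + B * (potential c (u + l) f - 1 - t u)"
      using overload_prob_stage[OF c1 T1 K, of m r k0 u] tr k0 large
      unfolding t_def \<phi>_def by blast
    \<comment> \<open>The slope term vanishes, since S x 0 attains the least potential.\<close>
    have "overload_prob l T u (embed_load u l S) \<le> 384 * r\<^sup>2 + 144 * r\<^sup>2 * (\<phi> k0 - \<phi> u) - 2 * B * (t u)\<^sup>2"
      using bound[OF sum_embed_load[OF S, folded m_def]] by (simp add: potential_embed_load[OF S] t_def m_def)
    also have "\<dots> \<le> 384 * r\<^sup>2 + 144 * r\<^sup>2 * 1"
    proof -
      have "\<phi> k0 \<le> 1" "\<phi> u \<ge> 0" using T0 by (simp_all add: \<phi>_def field_simps add_pos_pos)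
      then have "144 * r\<^sup>2 * (\<phi> k0 - \<phi> u) \<le> 144 * r\<^sup>2 * 1" by (intro mult_left_mono) auto
      moreover have "0 \<le> 2 * B * (t u)\<^sup>2" using B by simp
      ultimately show ?thesis by linarith
    qed
    also have "\<dots> = 528 * E\<^sup>2 * (lam * n powr (1 / T) / T)\<^sup>2"
      unfolding r_def N_def power_mult_distrib by simp
    finally show ?thesis by (simp add: prob_lin_eq_overload_prob[OF S])
  qed
  then show ?thesis
    using E by (intro exI[of _ "528 * E\<^sup>2"] exI[of _ "4 * E"]) (auto simp: Let_def)
qed

end
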